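(* Let $R$ be a ring. Every left $R$-module that has a composition series is supplementing, and every left $R$-module that has a composition series is Rad-supplementing.
   Context: Rings are associative with identity and modules are unitary left modules. For a module $M$, $\operatorname{Rad} M$ denotes the radical of $M$ (the intersection of all maximal submodules of $M$, equal to $M$ if there are none). A submodule $K\subseteq M$ is small in $M$, written $K\ll M$, if $M\neq K+T$ for every proper submodule $T$ of $M$. For submodules $U,V$ of a module $N$: $V$ is a supplement of $U$ in $N$ if $U+V=N$ and $U\cap V\ll V$; $V$ is a Rad-supplement of $U$ in $N$ if $U+V=N$ and $U\cap V\subseteq \operatorname{Rad} V$. A module $M$ is supplementing (respectively Rad-supplementing) if $M$ has a supplement (respectively a Rad-supplement) in every module $N$ that contains $M$ as a submodule. *)

theory Defs
  imports "HOL-Algebra.Module" "HOL-Algebra.AbelCoset"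
begin

text \<open>
  The library locale \<^locale>\<open>module\<close> requires the ring to be commutative. The following locale has the
  same axioms over an arbitrary ring with identity. The library's \<^locale>\<open>submodule\<close> does not
  assume commutativity and is used unchanged. A submodule \<open>V\<close> of \<open>N\<close>, regarded as a module, is
  \<open>N\<lparr>carrier := V\<rparr>\<close>.
\<close>

locale left_module = R?: ring R + M?: abelian_group M
  for R (structure) and M :: "('a, 'b, 'c) module_scheme" (structure) +
  assumes smult_closed [simp, intro]:
      "\<lbrakk>a \<in> carrier R; x \<in> carrier M\<rbrakk> \<Longrightarrow> a \<odot>\<^bsub>M\<^esub> x \<in> carrier M"
    and smult_l_distr:
      "\<lbrakk>a \<in> carrier R; b \<in> carrier R; x \<in> carrier M\<rbrakk> \<Longrightarrow>
      (a \<oplus> b) \<odot>\<^bsub>M\<^esub> x = a \<odot>\<^bsub>M\<^esub> x \<oplus>\<^bsub>M\<^esub> b \<odot>\<^bsub>M\<^esub> x"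
    and smult_r_distr:
      "\<lbrakk>a \<in> carrier R; x \<in> carrier M; y \<in> carrier M\<rbrakk> \<Longrightarrow>
      a \<odot>\<^bsub>M\<^esub> (x \<oplus>\<^bsub>M\<^esub> y) = a \<odot>\<^bsub>M\<^esub> x \<oplus>\<^bsub>M\<^esub> a \<odot>\<^bsub>M\<^esub> y"
    and smult_assoc1:
      "\<lbrakk>a \<in> carrier R; b \<in> carrier R; x \<in> carrier M\<rbrakk> \<Longrightarrow>
      (a \<otimes> b) \<odot>\<^bsub>M\<^esub> x = a \<odot>\<^bsub>M\<^esub> (b \<odot>\<^bsub>M\<^esub> x)"
    and smult_one [simp]:
      "x \<in> carrier M \<Longrightarrow> \<one> \<odot>\<^bsub>M\<^esub> x = x"

lemma module_iff_left_module: "module R M \<longleftrightarrow> cring R \<and> left_module R M"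
  unfolding module_def left_module_def module_axioms_def left_module_axioms_def
  by (auto dest: cring.axioms)

definition maximal_submodule ::
    "('r, 'd) ring_scheme \<Rightarrow> ('r, 'm, 'e) module_scheme \<Rightarrow> 'm set \<Rightarrow> bool"
  where "maximal_submodule R M K \<longleftrightarrow>
    submodule K R M \<and> K \<noteq> carrier M \<and>
    (\<forall>L. submodule L R M \<and> K \<subseteq> L \<longrightarrow> L = K \<or> L = carrier M)"

text \<open>Intersecting with the carrier gives the value \<open>carrier M\<close> when there is no maximal submodule.\<close>

definition Rad :: "('r, 'd) ring_scheme \<Rightarrow> ('r, 'm, 'e) module_scheme \<Rightarrow> 'm set"
  where "Rad R M = carrier M \<inter> \<Inter> {K. maximal_submodule R M K}"

definition small_submodule ::
    "('r, 'd) ring_scheme \<Rightarrow> ('r, 'm, 'e) module_scheme \<Rightarrow> 'm set \<Rightarrow> bool"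
  where "small_submodule R M K \<longleftrightarrow>
    submodule K R M \<and>
    (\<forall>T. submodule T R M \<and> T \<noteq> carrier M \<longrightarrow> carrier M \<noteq> K <+>\<^bsub>M\<^esub> T)"

definition is_supplement ::
    "('r, 'd) ring_scheme \<Rightarrow> ('r, 'n, 'e) module_scheme \<Rightarrow> 'n set \<Rightarrow> 'n set \<Rightarrow> bool"
  where "is_supplement R N U V \<longleftrightarrow>
    submodule U R N \<and> submodule V R N \<and>
    U <+>\<^bsub>N\<^esub> V = carrier N \<and> small_submodule R (N\<lparr>carrier := V\<rparr>) (U \<inter> V)"

definition is_Rad_supplement ::
    "('r, 'd) ring_scheme \<Rightarrow> ('r, 'n, 'e) module_scheme \<Rightarrow> 'n set \<Rightarrow> 'n set \<Rightarrow> bool"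
  where "is_Rad_supplement R N U V \<longleftrightarrow>
    submodule U R N \<and> submodule V R N \<and>
    U <+>\<^bsub>N\<^esub> V = carrier N \<and> U \<inter> V \<subseteq> Rad R (N\<lparr>carrier := V\<rparr>)"

definition module_embedding ::
    "('r, 'd) ring_scheme \<Rightarrow> ('r, 'm, 'e) module_scheme \<Rightarrow> ('r, 'n, 'k) module_scheme \<Rightarrow>
      ('m \<Rightarrow> 'n) \<Rightarrow> bool"
  where "module_embedding R M N f \<longleftrightarrow>
    f \<in> carrier M \<rightarrow> carrier N \<and> inj_on f (carrier M) \<and>
    (\<forall>x\<in>carrier M. \<forall>y\<in>carrier M. f (x \<oplus>\<^bsub>M\<^esub> y) = f x \<oplus>\<^bsub>N\<^esub> f y) \<and>
    (\<forall>r\<in>carrier R. \<forall>x\<in>carrier M. f (r \<odot>\<^bsub>M\<^esub> x) = r \<odot>\<^bsub>N\<^esub> f x)"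

text \<open>
  A module \<open>N\<close> containing \<open>M\<close> as a submodule may need a larger type than that of the elements of
  \<open>M\<close>, so containment is expressed by an embedding \<open>f\<close> of \<open>M\<close> into \<open>N\<close>, with \<open>M\<close> identified with its
  image. HOL formulas cannot quantify over types, so the type \<open>'n\<close> of the elements of the
  extensions is a parameter; a theorem with \<open>'n\<close> as a free type variable covers all extensions. Literal
  containment is the special case in which \<open>f\<close> is an inclusion.
\<close>

definition supplementing ::
    "'n itself \<Rightarrow> ('r, 'd) ring_scheme \<Rightarrow> ('r, 'm, 'e) module_scheme \<Rightarrow> bool"
  where "supplementing (_ :: 'n itself) R M \<longleftrightarrow>
    (\<forall>(N :: ('r, 'n) module) f. left_module R N \<and> module_embedding R M N f \<longrightarrow>
      (\<exists>V. is_supplement R N (f ` carrier M) V))"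

definition Rad_supplementing ::
    "'n itself \<Rightarrow> ('r, 'd) ring_scheme \<Rightarrow> ('r, 'm, 'e) module_scheme \<Rightarrow> bool"
  where "Rad_supplementing (_ :: 'n itself) R M \<longleftrightarrow>
    (\<forall>(N :: ('r, 'n) module) f. left_module R N \<and> module_embedding R M N f \<longrightarrow>
      (\<exists>V. is_Rad_supplement R N (f ` carrier M) V))"

lemma module_embedding_inclusion:
  "submodule U R N \<Longrightarrow> module_embedding R (N\<lparr>carrier := U\<rparr>) N (\<lambda>x. x)"
  unfolding module_embedding_def submodule_def subgroup_def by auto

text \<open>
  The quotient \<open>M/H\<close> as a module. The fields \<open>mult\<close> and \<open>one\<close> inherited from the ring record play
  no role for modules.
\<close>

definition quotient_module ::
    "('r, 'm, 'e) module_scheme \<Rightarrow> 'm set \<Rightarrow> ('r, 'm set) module"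
  where "quotient_module M H =
    \<lparr>carrier = a_rcosets\<^bsub>M\<^esub> H, mult = undefined, one = undefined,
     zero = H, add = set_add M,
     smult = (\<lambda>r C. \<Union>x\<in>C. H +>\<^bsub>M\<^esub> (r \<odot>\<^bsub>M\<^esub> x))\<rparr>"

lemma quotient_module_smult:
  assumes M: "left_module R M" and H: "submodule H R M"
    and r: "r \<in> carrier R" and x: "x \<in> carrier M"
  shows "r \<odot>\<^bsub>quotient_module M H\<^esub> (H +>\<^bsub>M\<^esub> x) = H +>\<^bsub>M\<^esub> (r \<odot>\<^bsub>M\<^esub> x)"
proof -
  interpret left_module R M by fact
  have sg: "subgroup H (add_monoid M)" and sub: "H \<subseteq> carrier M"
    using H subgroup.subset[of H "add_monoid M"] by (auto simp: submodule_def)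
  have eq: "H +>\<^bsub>M\<^esub> (r \<odot>\<^bsub>M\<^esub> y) = H +>\<^bsub>M\<^esub> (r \<odot>\<^bsub>M\<^esub> x)" if y: "y \<in> H +>\<^bsub>M\<^esub> x" for y
  proof -
    obtain h where h: "h \<in> H" "y = h \<oplus>\<^bsub>M\<^esub> x"
      using y by (auto simp: a_r_coset_def')
    have "r \<odot>\<^bsub>M\<^esub> y \<in> H +>\<^bsub>M\<^esub> (r \<odot>\<^bsub>M\<^esub> x)"
      using h r x sub submodule.smult_closed[OF H r h(1)]
      by (auto simp: a_r_coset_def' smult_r_distr[OF r _ x] subsetD)
    then show ?thesis
      using a_repr_independence'[OF _ _ sg] r x by (simp add: a_r_coset_def)
  qed
  have "x \<in> H +>\<^bsub>M\<^esub> x"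
    using add.rcos_self[OF x sg] by (simp add: a_r_coset_def)
  then have "(\<Union>y\<in>H +>\<^bsub>M\<^esub> x. H +>\<^bsub>M\<^esub> (r \<odot>\<^bsub>M\<^esub> y)) = H +>\<^bsub>M\<^esub> (r \<odot>\<^bsub>M\<^esub> x)"
    using eq by blast
  then show ?thesis
    by (simp add: quotient_module_def)
qed

lemma left_module_quotient_module:
  assumes M: "left_module R M" and H: "submodule H R M"
  shows "left_module R (quotient_module M H)"
proof -
  interpret left_module R M by fact
  have "additive_subgroup H M"
    using H by (simp add: additive_subgroup_def submodule_def)
  then interpret H: abelian_subgroup H M
    using abelian_subgroupI3 M.abelian_group_axioms by blast
  let ?Q = "quotient_module M H"
  have car: "carrier ?Q = (\<lambda>x. H +>\<^bsub>M\<^esub> x) ` carrier M"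
    by (auto simp: quotient_module_def A_RCOSETS_def')
  have add: "(H +>\<^bsub>M\<^esub> x) \<oplus>\<^bsub>?Q\<^esub> (H +>\<^bsub>M\<^esub> y) = H +>\<^bsub>M\<^esub> (x \<oplus>\<^bsub>M\<^esub> y)"
    if "x \<in> carrier M" "y \<in> carrier M" for x y
    using H.a_rcos_sum that by (simp add: quotient_module_def)
  have sm: "r \<odot>\<^bsub>?Q\<^esub> (H +>\<^bsub>M\<^esub> x) = H +>\<^bsub>M\<^esub> (r \<odot>\<^bsub>M\<^esub> x)"
    if "r \<in> carrier R" "x \<in> carrier M" for r x
    using quotient_module_smult[OF M H that] .
  have zero: "\<zero>\<^bsub>?Q\<^esub> = H +>\<^bsub>M\<^esub> \<zero>\<^bsub>M\<^esub>"
    using H.a_subset by (simp add: quotient_module_def)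
  have "abelian_group ?Q"
  proof (rule abelian_groupI)
    fix X assume "X \<in> carrier ?Q"
    then obtain x where x: "x \<in> carrier M" "X = H +>\<^bsub>M\<^esub> x" by (auto simp: car)
    then show "\<exists>Y\<in>carrier ?Q. Y \<oplus>\<^bsub>?Q\<^esub> X = \<zero>\<^bsub>?Q\<^esub>"
      by (intro bexI[of _ "H +>\<^bsub>M\<^esub> (\<ominus>\<^bsub>M\<^esub> x)"]) (auto simp: add zero car M.l_neg)
  qed (auto simp: car add zero M.a_ac)
  moreover have "left_module_axioms R ?Q"
    by unfold_locales
      (auto simp: car add sm smult_l_distr smult_r_distr smult_assoc1)
  ultimately show ?thesis
    using R.ring_axioms by (simp add: left_module_def)
qed

definition simple_module :: "('r, 'd) ring_scheme \<Rightarrow> ('r, 'm, 'e) module_scheme \<Rightarrow> bool"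
  where "simple_module R M \<longleftrightarrow>
    left_module R M \<and> carrier M \<noteq> {\<zero>\<^bsub>M\<^esub>} \<and>
    (\<forall>K. submodule K R M \<longrightarrow> K = {\<zero>\<^bsub>M\<^esub>} \<or> K = carrier M)"

definition composition_series ::
    "('r, 'd) ring_scheme \<Rightarrow> ('r, 'm, 'e) module_scheme \<Rightarrow> nat \<Rightarrow> (nat \<Rightarrow> 'm set) \<Rightarrow> bool"
  where "composition_series R M n S \<longleftrightarrow>
    S 0 = {\<zero>\<^bsub>M\<^esub>} \<and> S n = carrier M \<and>
    (\<forall>i\<le>n. submodule (S i) R M) \<and>
    (\<forall>i<n. S i \<subseteq> S (Suc i) \<and>
      simple_module R (quotient_module (M\<lparr>carrier := S (Suc i)\<rparr>) (S i)))"

definition has_composition_series ::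
    "('r, 'd) ring_scheme \<Rightarrow> ('r, 'm, 'e) module_scheme \<Rightarrow> bool"
  where "has_composition_series R M \<longleftrightarrow> (\<exists>n S. composition_series R M n S)"

end

theory Submission
  imports Defs
begin

text \<open>
  Let \<open>U\<close> be a submodule of \<open>N\<close> with a composition series. Among all \<open>V\<close> with \<open>U + V = N\<close> choose one for which
  \<open>U \<inter> V\<close> has minimal length. If \<open>(U \<inter> V) + T = V\<close> then \<open>U + T = N\<close>, so \<open>U \<inter> T = U \<inter> V\<close> by minimality,
  hence \<open>U \<inter> V \<subseteq> T\<close> and \<open>T = V\<close>. Thus \<open>U \<inter> V\<close> is small in \<open>V\<close>, and small submodules lie in the radical.
\<close>

section \<open>Submodules of a left module: sums, intersections and restriction\<close>

lemma mem_set_add: "z \<in> A <+>\<^bsub>M\<^esub> B \<longleftrightarrow> (\<exists>a\<in>A. \<exists>b\<in>B. z = a \<oplus>\<^bsub>M\<^esub> b)"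
  by (auto simp: set_add_def')

context left_module
begin

lemma smult_l_null:
  assumes x: "x \<in> carrier M"
  shows "\<zero>\<^bsub>R\<^esub> \<odot>\<^bsub>M\<^esub> x = \<zero>\<^bsub>M\<^esub>"
proof -
  have c: "\<zero>\<^bsub>R\<^esub> \<odot>\<^bsub>M\<^esub> x \<in> carrier M" using x by simp
  have "\<zero>\<^bsub>R\<^esub> \<odot>\<^bsub>M\<^esub> x \<oplus>\<^bsub>M\<^esub> \<zero>\<^bsub>R\<^esub> \<odot>\<^bsub>M\<^esub> x = (\<zero>\<^bsub>R\<^esub> \<oplus>\<^bsub>R\<^esub> \<zero>\<^bsub>R\<^esub>) \<odot>\<^bsub>M\<^esub> x"
    using x by (subst smult_l_distr) auto
  also have "\<dots> = \<zero>\<^bsub>R\<^esub> \<odot>\<^bsub>M\<^esub> x" by simp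
  finally show ?thesis using c M.add.r_cancel_one by blast
qed

lemma smult_minus_one:
  assumes x: "x \<in> carrier M"
  shows "(\<ominus>\<^bsub>R\<^esub> \<one>\<^bsub>R\<^esub>) \<odot>\<^bsub>M\<^esub> x = \<ominus>\<^bsub>M\<^esub> x"
proof -
  have "(\<ominus>\<^bsub>R\<^esub> \<one>\<^bsub>R\<^esub>) \<odot>\<^bsub>M\<^esub> x \<oplus>\<^bsub>M\<^esub> x = (\<ominus>\<^bsub>R\<^esub> \<one>\<^bsub>R\<^esub> \<oplus>\<^bsub>R\<^esub> \<one>\<^bsub>R\<^esub>) \<odot>\<^bsub>M\<^esub> x"
    using x by (subst smult_l_distr) auto
  also have "\<dots> = \<zero>\<^bsub>M\<^esub>" using x by (simp add: R.l_neg smult_l_null)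
  finally show ?thesis
    using x by (metis M.minus_equality R.a_inv_closed R.one_closed smult_closed)
qed

text \<open>Since \<open>-x = (-1) x\<close>, closure under negation follows from closure under
  scalars. This leaves elementwise conditions that automation can check directly.\<close>

lemma submodule_iff:
  "submodule H R M \<longleftrightarrow> H \<subseteq> carrier M \<and> \<zero>\<^bsub>M\<^esub> \<in> H \<and>
    (\<forall>x\<in>H. \<forall>y\<in>H. x \<oplus>\<^bsub>M\<^esub> y \<in> H) \<and> (\<forall>r\<in>carrier R. \<forall>x\<in>H. r \<odot>\<^bsub>M\<^esub> x \<in> H)" (is "_ \<longleftrightarrow> ?r")
proof
  assume "submodule H R M"
  then show ?r
    unfolding submodule_def submodule_axioms_def subgroup_def by auto
next
  assume r: ?r
  then have "\<ominus>\<^bsub>M\<^esub> x \<in> H" if "x \<in> H" for x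
    using smult_minus_one[of x] that by (metis R.a_inv_closed R.one_closed subsetD)
  with r show "submodule H R M"
    unfolding submodule_def submodule_axioms_def subgroup_def by (auto simp: a_inv_def)
qed

lemma submodule_minus:
  assumes "submodule H R M" "x \<in> H"
  shows "\<ominus>\<^bsub>M\<^esub> x \<in> H"
  using assms unfolding submodule_iff
  by (metis smult_minus_one R.a_inv_closed R.one_closed subsetD)

lemma left_module_submodule:
  assumes V: "submodule V R M"
  shows "left_module R (M\<lparr>carrier := V\<rparr>)"
proof -
  have v: "V \<subseteq> carrier M" "\<zero>\<^bsub>M\<^esub> \<in> V"
    "\<And>x y. x \<in> V \<Longrightarrow> y \<in> V \<Longrightarrow> x \<oplus>\<^bsub>M\<^esub> y \<in> V"
    "\<And>r x. r \<in> carrier R \<Longrightarrow> x \<in> V \<Longrightarrow> r \<odot>\<^bsub>M\<^esub> x \<in> V"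
    using V by (auto simp: submodule_iff)
  then have c: "\<And>x. x \<in> V \<Longrightarrow> x \<in> carrier M" by blast
  have "abelian_group (M\<lparr>carrier := V\<rparr>)"
  proof (rule abelian_groupI)
    fix x assume "x \<in> carrier (M\<lparr>carrier := V\<rparr>)"
    then show "\<exists>y\<in>carrier (M\<lparr>carrier := V\<rparr>). y \<oplus>\<^bsub>M\<lparr>carrier := V\<rparr>\<^esub> x = \<zero>\<^bsub>M\<lparr>carrier := V\<rparr>\<^esub>"
      using submodule_minus[OF V] by (auto intro!: bexI[of _ "\<ominus>\<^bsub>M\<^esub> x"] simp: M.l_neg c)
  qed (auto simp: v c M.a_ac)
  moreover have "left_module_axioms R (M\<lparr>carrier := V\<rparr>)"
    by unfold_locales (auto simp: v c smult_l_distr smult_r_distr smult_assoc1)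
  ultimately show ?thesis
    using R.ring_axioms by (simp add: left_module_def)
qed

text \<open>Lets smallness in \<open>V\<close>, and the factors of a series, be treated through
  submodules of the ambient module alone.\<close>

lemma submodule_submodule_iff:
  assumes V: "submodule V R M"
  shows "submodule T R (M\<lparr>carrier := V\<rparr>) \<longleftrightarrow> submodule T R M \<and> T \<subseteq> V"
proof -
  interpret V: left_module R "M\<lparr>carrier := V\<rparr>"
    using left_module_submodule[OF V] .
  show ?thesis
    using V unfolding V.submodule_iff by (auto simp: submodule_iff)
qed

lemma submodule_Int:
  assumes "submodule A R M" "submodule B R M"
  shows "submodule (A \<inter> B) R M"
  using assms by (auto simp: submodule_iff)

lemma submodule_set_add:
  assumes A: "submodule A R M" and B: "submodule B R M"
  shows "submodule (A <+>\<^bsub>M\<^esub> B) R M"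
  unfolding submodule_iff
proof (intro conjI ballI)
  have a: "A \<subseteq> carrier M" and b: "B \<subseteq> carrier M"
    using A B by (auto simp: submodule_iff)
  show "A <+>\<^bsub>M\<^esub> B \<subseteq> carrier M"
    using a b by (force simp: mem_set_add)
  have "\<zero>\<^bsub>M\<^esub> = \<zero>\<^bsub>M\<^esub> \<oplus>\<^bsub>M\<^esub> \<zero>\<^bsub>M\<^esub>" by simp
  then show "\<zero>\<^bsub>M\<^esub> \<in> A <+>\<^bsub>M\<^esub> B"
    using A B unfolding mem_set_add submodule_iff by blast
next
  fix x y assume "x \<in> A <+>\<^bsub>M\<^esub> B" "y \<in> A <+>\<^bsub>M\<^esub> B"
  then obtain p q s t where xy: "p \<in> A" "q \<in> B" "x = p \<oplus>\<^bsub>M\<^esub> q" "s \<in> A" "t \<in> B" "y = s \<oplus>\<^bsub>M\<^esub> t"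
    unfolding mem_set_add by blast
  then have "p \<in> carrier M" "q \<in> carrier M" "s \<in> carrier M" "t \<in> carrier M"
    using A B by (auto simp: submodule_iff)
  then have "x \<oplus>\<^bsub>M\<^esub> y = (p \<oplus>\<^bsub>M\<^esub> s) \<oplus>\<^bsub>M\<^esub> (q \<oplus>\<^bsub>M\<^esub> t)"
    using xy by (simp add: M.a_ac)
  then show "x \<oplus>\<^bsub>M\<^esub> y \<in> A <+>\<^bsub>M\<^esub> B"
    using xy A B unfolding mem_set_add submodule_iff by blast
next
  fix r x assume r: "r \<in> carrier R" and "x \<in> A <+>\<^bsub>M\<^esub> B"
  then obtain p q where x: "p \<in> A" "q \<in> B" "x = p \<oplus>\<^bsub>M\<^esub> q"
    unfolding mem_set_add by blast
  then have "p \<in> carrier M" "q \<in> carrier M"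
    using A B by (auto simp: submodule_iff)
  then have "r \<odot>\<^bsub>M\<^esub> x = r \<odot>\<^bsub>M\<^esub> p \<oplus>\<^bsub>M\<^esub> r \<odot>\<^bsub>M\<^esub> q"
    using x r by (simp add: smult_r_distr)
  then show "r \<odot>\<^bsub>M\<^esub> x \<in> A <+>\<^bsub>M\<^esub> B"
    using x r A B unfolding mem_set_add submodule_iff by blast
qed

lemma subset_set_add:
  assumes "submodule A R M" "submodule B R M"
  shows "A \<subseteq> A <+>\<^bsub>M\<^esub> B" "B \<subseteq> A <+>\<^bsub>M\<^esub> B"
proof -
  have *: "\<zero>\<^bsub>M\<^esub> \<in> A" "\<zero>\<^bsub>M\<^esub> \<in> B" "A \<subseteq> carrier M" "B \<subseteq> carrier M"
    using assms by (auto simp: submodule_iff)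
  show "A \<subseteq> A <+>\<^bsub>M\<^esub> B"
    using * unfolding mem_set_add subset_iff by (metis M.r_zero)
  show "B \<subseteq> A <+>\<^bsub>M\<^esub> B"
    using * unfolding mem_set_add subset_iff by (metis M.l_zero)
qed

lemma set_add_subset:
  assumes "submodule C R M" "A \<subseteq> C" "B \<subseteq> C"
  shows "A <+>\<^bsub>M\<^esub> B \<subseteq> C"
  using assms unfolding submodule_iff subset_iff mem_set_add by blast

lemma submodule_carrier: "submodule (carrier M) R M"
  by (auto simp: submodule_iff)

section \<open>Small submodules and the radical\<close>

text \<open>A maximal submodule \<open>L\<close> is proper, so smallness keeps \<open>K + L\<close>
  proper. Maximality then forces \<open>K + L = L\<close>, which contains \<open>K\<close>.\<close>

lemma small_submodule_subset_Rad:
  assumes small: "small_submodule R M K"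
  shows "K \<subseteq> Rad R M"
proof -
  have K: "submodule K R M"
    using small by (simp add: small_submodule_def)
  have "K \<subseteq> L" if L: "maximal_submodule R M L" for L
  proof -
    have l: "submodule L R M" "L \<noteq> carrier M"
      using L by (auto simp: maximal_submodule_def)
    then have "K <+>\<^bsub>M\<^esub> L \<noteq> carrier M"
      using small by (auto simp: small_submodule_def)
    then have "K <+>\<^bsub>M\<^esub> L = L"
      using L submodule_set_add[OF K l(1)] subset_set_add[OF K l(1)]
      by (auto simp: maximal_submodule_def)
    then show ?thesis
      using subset_set_add[OF K l(1)] by simp
  qed
  then show ?thesis
    using K by (auto simp: Rad_def submodule_iff)
qed

text \<open>The inclusion of small submodules in the radical, applied inside \<open>V\<close>,
  reduces the Rad-supplement claim to the supplement claim.\<close>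

lemma is_supplement_imp_is_Rad_supplement:
  assumes "is_supplement R M U V"
  shows "is_Rad_supplement R M U V"
proof -
  have V: "submodule V R M"
    using assms by (simp add: is_supplement_def)
  interpret V: left_module R "M\<lparr>carrier := V\<rparr>"
    using left_module_submodule[OF V] .
  show ?thesis
    using assms V.small_submodule_subset_Rad
    by (auto simp: is_supplement_def is_Rad_supplement_def)
qed

section \<open>Submodules lying above the kernel of a simple quotient\<close>

lemma rcos_eqD:
  assumes H: "submodule H R M" and x: "x \<in> carrier M"
    and eq: "H +>\<^bsub>M\<^esub> x = H +>\<^bsub>M\<^esub> y"
  shows "\<exists>h\<in>H. x = h \<oplus>\<^bsub>M\<^esub> y"
proof -
  have "x = \<zero>\<^bsub>M\<^esub> \<oplus>\<^bsub>M\<^esub> x" using x by simp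
  then have "x \<in> H +>\<^bsub>M\<^esub> x"
    using H unfolding a_r_coset_def' submodule_iff by blast
  then have "x \<in> H +>\<^bsub>M\<^esub> y"
    using eq by simp
  then show ?thesis
    unfolding a_r_coset_def' by blast
qed

text \<open>The image of \<open>K\<close> in the quotient is a submodule, hence zero or everything.
  Because \<open>K\<close> contains \<open>H\<close>, it is determined by that image.\<close>

lemma simple_quotient_no_intermediate:
  assumes H: "submodule H R M" and K: "submodule K R M" and HK: "H \<subseteq> K"
    and simple: "simple_module R (quotient_module M H)"
  shows "K = H \<or> K = carrier M"
proof -
  let ?Q = "quotient_module M H"
  interpret Q: left_module R ?Q
    using simple by (simp add: simple_module_def)
  have "additive_subgroup H M"
    using H by (simp add: additive_subgroup_def submodule_def)
  then interpret H: abelian_subgroup H M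
    using abelian_subgroupI3 M.abelian_group_axioms by blast
  have k: "K \<subseteq> carrier M" using K by (simp add: submodule_iff)
  let ?K = "(\<lambda>x. H +>\<^bsub>M\<^esub> x) ` K"
  have car: "carrier ?Q = (\<lambda>x. H +>\<^bsub>M\<^esub> x) ` carrier M"
    by (auto simp: quotient_module_def A_RCOSETS_def')
  have zero: "\<zero>\<^bsub>?Q\<^esub> = H +>\<^bsub>M\<^esub> \<zero>\<^bsub>M\<^esub>"
    using H.a_subset by (simp add: quotient_module_def)
  have add: "(H +>\<^bsub>M\<^esub> x) \<oplus>\<^bsub>?Q\<^esub> (H +>\<^bsub>M\<^esub> y) = H +>\<^bsub>M\<^esub> (x \<oplus>\<^bsub>M\<^esub> y)"
    if "x \<in> K" "y \<in> K" for x y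
    using H.a_rcos_sum that k by (auto simp: quotient_module_def)
  have sm: "r \<odot>\<^bsub>?Q\<^esub> (H +>\<^bsub>M\<^esub> x) = H +>\<^bsub>M\<^esub> (r \<odot>\<^bsub>M\<^esub> x)"
    if "r \<in> carrier R" "x \<in> K" for r x
    using quotient_module_smult[OF left_module_axioms H] that k by auto
  have "submodule ?K R ?Q"
    unfolding Q.submodule_iff
    using K by (auto simp: car zero add sm submodule_iff)
  then consider "?K = {\<zero>\<^bsub>?Q\<^esub>}" | "?K = carrier ?Q"
    using simple by (auto simp: simple_module_def)
  then show ?thesis
  proof cases
    case 1
    have "K \<subseteq> H"
    proof
      fix x assume x: "x \<in> K"
      then have "H +>\<^bsub>M\<^esub> x = H +>\<^bsub>M\<^esub> \<zero>\<^bsub>M\<^esub>"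
        using 1 by (auto simp: zero)
      then obtain h where "h \<in> H" "x = h \<oplus>\<^bsub>M\<^esub> \<zero>\<^bsub>M\<^esub>"
        using rcos_eqD[OF H] x k by blast
      then show "x \<in> H"
        using H.a_subset by auto
    qed
    then show ?thesis using HK by blast
  next
    case 2
    have "carrier M \<subseteq> K"
    proof
      \<comment> \<open>The coset of \<open>x\<close> is also the coset of some \<open>y\<close> in
        \<open>K\<close>, so \<open>x\<close> differs from \<open>y\<close> by an element of
        \<open>H\<close>, which lies in \<open>K\<close>.\<close>
      fix x assume x: "x \<in> carrier M"
      then obtain y where y: "y \<in> K" "H +>\<^bsub>M\<^esub> x = H +>\<^bsub>M\<^esub> y"
        using 2 car by (metis imageE imageI)
      then obtain h where "h \<in> H" "x = h \<oplus>\<^bsub>M\<^esub> y"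
        using rcos_eqD[OF H x] by blast
      then show "x \<in> K"
        using y HK K by (auto simp: submodule_iff)
    qed
    then show ?thesis using k by blast
  qed
qed

end

text \<open>
  The length of a submodule \<open>W\<close>, read off from a composition series: the factors of the series that
  \<open>W\<close> meets nontrivially are exactly the composition factors of \<open>W\<close>.
\<close>

definition factor_set :: "nat \<Rightarrow> (nat \<Rightarrow> 'm set) \<Rightarrow> 'm set \<Rightarrow> nat set"
  where "factor_set n S W = {i. i < n \<and> \<not> W \<inter> S (Suc i) \<subseteq> S i}"

lemma finite_factor_set: "finite (factor_set n S W)"
  by (simp add: factor_set_def)

lemma factor_set_mono: "W \<subseteq> W' \<Longrightarrow> factor_set n S W \<subseteq> factor_set n S W'"
  by (auto simp: factor_set_def)

text \<open>Strict monotonicity of length. Climbing the series, each simple factor either receives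
  nothing from \<open>W'\<close> or is already filled by \<open>W\<close>, so \<open>W'\<close>
  never gains an element over \<open>W\<close>.\<close>

lemma (in left_module) factor_set_eq_imp_eq:
  assumes cs: "composition_series R M n S"
    and W: "submodule W R M" and W': "submodule W' R M" and sub: "W \<subseteq> W'"
    and eq: "factor_set n S W = factor_set n S W'"
  shows "W = W'"
proof -
  have "W' \<inter> S i \<subseteq> W" if "i \<le> n" for i
    using that
  proof (induction i)
    case 0
    then show ?case using cs W by (auto simp: composition_series_def submodule_iff)
  next
    case (Suc i)
    have Si: "submodule (S i) R M" and Ss: "submodule (S (Suc i)) R M"
      and le: "S i \<subseteq> S (Suc i)"
      and simple: "simple_module R (quotient_module (M\<lparr>carrier := S (Suc i)\<rparr>) (S i))"
      using cs Suc.prems by (auto simp: composition_series_def)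
    interpret S: left_module R "M\<lparr>carrier := S (Suc i)\<rparr>"
      using left_module_submodule[OF Ss] .
    show ?case
    proof (cases "i \<in> factor_set n S W")
      \<comment> \<open>Equality of the factor sets makes \<open>W'\<close> miss this factor too, so
        nothing new appears beyond level \<open>i\<close>.\<close>
      case False
      then have "W' \<inter> S (Suc i) \<subseteq> S i"
        using eq Suc.prems by (auto simp: factor_set_def)
      then show ?thesis using Suc by auto
    next
      case True
      let ?A = "W \<inter> S (Suc i)"
      have A: "submodule ?A R M"
        using W Ss by (rule submodule_Int)
      \<comment> \<open>\<open>?K\<close> lies between \<open>S i\<close> and
        \<open>S (Suc i)\<close>, so simplicity makes it one of the two. It is not the lower one,
        because \<open>W\<close> meets this factor nontrivially.\<close>
      let ?K = "?A <+>\<^bsub>M\<^esub> S i"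
      note K = submodule_set_add[OF A Si] subset_set_add[OF A Si]
        set_add_subset[OF Ss _ le, of ?A]
      have "?K = S i \<or> ?K = S (Suc i)"
        using S.simple_quotient_no_intermediate[of "S i" ?K] K le Si simple
        by (simp add: submodule_submodule_iff[OF Ss])
      moreover have "?K \<noteq> S i"
        using True K(2) by (auto simp: factor_set_def)
      ultimately have KS: "?K = S (Suc i)" by blast
      show ?thesis
      proof
        fix x assume x: "x \<in> W' \<inter> S (Suc i)"
        then obtain w s where ws: "w \<in> W" "s \<in> S i" "x = w \<oplus>\<^bsub>M\<^esub> s"
          using KS mem_set_add[of x M ?A "S i"] by blast
        have c: "w \<in> carrier M" "s \<in> carrier M"
          using ws W Si by (auto simp: submodule_iff)
        \<comment> \<open>The modular law in elements: subtracting \<open>w\<close> moves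
          \<open>x\<close> down into \<open>W' \<inter> S i\<close>, where the induction hypothesis
          applies.\<close>
        have "s = \<ominus>\<^bsub>M\<^esub> w \<oplus>\<^bsub>M\<^esub> x"
          using ws c by (simp add: M.r_neg1)
        moreover have "\<ominus>\<^bsub>M\<^esub> w \<in> W'"
          using submodule_minus[OF W ws(1)] sub by blast
        ultimately have "s \<in> W'"
          using x W' by (auto simp: submodule_iff)
        then have "s \<in> W"
          using Suc ws by auto
        then show "x \<in> W"
          using ws W by (auto simp: submodule_iff)
      qed
    qed
  qed
  from this[of n] have "W' \<inter> carrier M \<subseteq> W"
    using cs by (simp add: composition_series_def)
  then show ?thesis
    using sub W' by (auto simp: submodule_iff)
qed

section \<open>Supplements in an arbitrary extension\<close>

text \<open>Preimages carry submodules of \<open>N\<close> back to \<open>M\<close>, where the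
  composition series lives.\<close>

lemma module_embedding_submodules:
  assumes "left_module R M" "left_module R N" "module_embedding R M N f"
  shows "submodule (f ` carrier M) R N"
    and "submodule V R N \<Longrightarrow> submodule {x \<in> carrier M. f x \<in> V} R M"
proof -
  interpret M: left_module R M by fact
  interpret N: left_module R N by fact
  have f: "\<And>x. x \<in> carrier M \<Longrightarrow> f x \<in> carrier N"
    "\<And>x y. x \<in> carrier M \<Longrightarrow> y \<in> carrier M \<Longrightarrow> f (x \<oplus>\<^bsub>M\<^esub> y) = f x \<oplus>\<^bsub>N\<^esub> f y"
    "\<And>r x. r \<in> carrier R \<Longrightarrow> x \<in> carrier M \<Longrightarrow> f (r \<odot>\<^bsub>M\<^esub> x) = r \<odot>\<^bsub>N\<^esub> f x"
    using assms(3) by (auto simp: module_embedding_def)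
  \<comment> \<open>Preservation of zero comes from applying \<open>f\<close> to the zero scalar
    times zero.\<close>
  have f0: "f \<zero>\<^bsub>M\<^esub> = \<zero>\<^bsub>N\<^esub>"
    using f(3)[of "\<zero>\<^bsub>R\<^esub>" "\<zero>\<^bsub>M\<^esub>"] f(1)[of "\<zero>\<^bsub>M\<^esub>"] by (simp add: M.smult_l_null N.smult_l_null)
  show "submodule (f ` carrier M) R N"
    unfolding N.submodule_iff
  proof (intro conjI ballI)
    show "\<zero>\<^bsub>N\<^esub> \<in> f ` carrier M" using f0 by (metis M.zero_closed imageI)
  qed (auto simp: f simp flip: f(2,3))
  show "submodule {x \<in> carrier M. f x \<in> V} R M" if "submodule V R N"
    using that f f0 by (auto simp: N.submodule_iff M.submodule_iff)
qed

lemma supplement_exists: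
  assumes M: "left_module R M" and N: "left_module R N" and emb: "module_embedding R M N f"
    and cs: "composition_series R M n S"
  shows "\<exists>V. is_supplement R N (f ` carrier M) V"
proof -
  interpret M: left_module R M by fact
  interpret N: left_module R N by fact
  let ?U = "f ` carrier M"
  \<comment> \<open>The length of \<open>?U \<inter> V\<close> is measured on its preimage in
    \<open>M\<close>.\<close>
  let ?pre = "\<lambda>V. {x \<in> carrier M. f x \<in> V}"
  note U = module_embedding_submodules(1)[OF M N emb]
  note pre = module_embedding_submodules(2)[OF M N emb]
  let ?P = "\<lambda>V. submodule V R N \<and> ?U <+>\<^bsub>N\<^esub> V = carrier N"
  \<comment> \<open>Some admissible \<open>V\<close> must exist before one with least length can be
    chosen.\<close>
  have "?P (carrier N)"
    using N.submodule_carrier N.subset_set_add[OF U N.submodule_carrier]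
      N.set_add_subset[OF N.submodule_carrier, of ?U "carrier N"] U
    by (auto simp: N.submodule_iff)
  then obtain V where V: "submodule V R N" and UV: "?U <+>\<^bsub>N\<^esub> V = carrier N"
    and min: "\<And>T. ?P T \<Longrightarrow> card (factor_set n S (?pre V)) \<le> card (factor_set n S (?pre T))"
    using ex_has_least_nat[of ?P "carrier N" "\<lambda>V. card (factor_set n S (?pre V))"] by blast
  have "T = V" if T: "submodule T R N" "T \<subseteq> V" and VT: "(?U \<inter> V) <+>\<^bsub>N\<^esub> T = V" for T
  proof -
    note UT = N.submodule_set_add[OF U T(1)] N.subset_set_add[OF U T(1)]
    have "V \<subseteq> ?U <+>\<^bsub>N\<^esub> T"
      using VT N.set_add_subset[OF UT(1), of "?U \<inter> V" T] UT by blast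
    then have "carrier N \<subseteq> ?U <+>\<^bsub>N\<^esub> T"
      using UV N.set_add_subset[OF UT(1), of ?U V] UT by blast
    then have "?P T"
      using T UT by (auto simp: N.submodule_iff)
    \<comment> \<open>\<open>T \<subseteq> V\<close> gives one inclusion of finite sets, and
      minimality of \<open>V\<close> gives the reverse comparison of cardinalities.\<close>
    then have "factor_set n S (?pre T) = factor_set n S (?pre V)"
      using min T(2) by (intro card_seteq finite_factor_set factor_set_mono) auto
    then have "?pre T = ?pre V"
      using T(2) by (intro M.factor_set_eq_imp_eq[OF cs pre[OF T(1)] pre[OF V]]) auto
    then have "?U \<inter> V \<subseteq> T" by blast
    then show "T = V"
      using VT T N.set_add_subset[OF T(1), of "?U \<inter> V" T] by blast
  qed
  \<comment> \<open>The sum formed in the restricted module unfolds to the same set as the sum in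
    \<open>N\<close>, so the implication just proved is smallness in contrapositive form.\<close>
  then have "small_submodule R (N\<lparr>carrier := V\<rparr>) (?U \<inter> V)"
    using N.submodule_Int[OF U V]
    by (simp add: small_submodule_def N.submodule_submodule_iff[OF V] set_add_def') metis
  then show ?thesis
    using U V UV unfolding is_supplement_def by blast
qed

theorem theorem2p12:
  fixes R :: "('r, 'd) ring_scheme" and M :: "('r, 'm) module"
  assumes "ring R" and "left_module R M" and "has_composition_series R M"
  shows "supplementing TYPE('n) R M \<and> Rad_supplementing TYPE('n) R M"
proof -
  obtain n S where "composition_series R M n S"
    using assms(3) by (auto simp: has_composition_series_def)
  then have "\<exists>V. is_supplement R N (f ` carrier M) V"
    if "left_module R N" "module_embedding R M N f" for N :: "('r, 'n) module" and f
    using supplement_exists[OF assms(2) that] by blast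
  then show ?thesis
    unfolding supplementing_def Rad_supplementing_def
    using left_module.is_supplement_imp_is_Rad_supplement by blast
qed

end
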